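(* Let $p\in(0,+\infty)$. The following property holds if and only if $p\in[2,+\infty)$: for every real-valued bounded Borel measurable function $f$ on $\ell^2$ there is a positive number $C(p,\sup_{\ell^2}|f|)$, depending only on $p$ and $\sup_{\ell^2}|f|$, such that $$\sum_{i=1}^\infty a_i^p\,\big|D_{x_i}(p_1f)(\mathbf x)\big|^p\le C\big(p,\sup_{\ell^2}|f|\big),\qquad\forall\,\mathbf x\in\ell^2.$$
   Context: $\ell^2$ is the real Hilbert space of square-summable sequences. Fix positive numbers $(a_i)_{i\ge1}$ with $\sum_ia_i<\infty$. $P$ is the Borel probability measure on $\ell^2$ obtained by restricting to $\ell^2$ the product measure $\prod_i\mathcal N_{a_i}$ on $\mathbb{R}^{\mathbb{N}}$, where $\mathcal N_a$ is the centered Gaussian measure on $\mathbb{R}$ with variance $a^2$. For a bounded Borel function $f:\ell^2\to\mathbb{R}$, $(p_1f)(\mathbf x)=\int_{\ell^2}f(\mathbf x+\mathbf y)\,P(d\mathbf y)$. $D_{x_i}$ denotes the partial derivative in the $i$-th coordinate direction (these partial derivatives of $p_1f$ exist at every point). "Depending only on $p$ and $\sup|f|$" means that the constant is the value at $(p,\sup_{\ell^2}|f|)$ of one fixed function, the same for all $f$. *)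

theory Defs
  imports "HOL-Probability.Probability"
begin

typedef ell2 = "{x :: nat \<Rightarrow> real. summable (\<lambda>i. (x i)\<^sup>2)}"
  morphisms coord Abs_ell2
  by (rule exI[of _ "\<lambda>_. 0"]) simp

setup_lifting type_definition_ell2

lemma summable_coord_sq: "summable (\<lambda>i. (coord x i)\<^sup>2)"
  using coord[of x] by simp

lemma ell2_eqI: "(\<And>i. coord x i = coord y i) \<Longrightarrow> x = y"
  by (simp add: coord_inject[symmetric] fun_eq_iff)

lemma summable_mult_if_summable_sq:
  fixes x y :: "nat \<Rightarrow> real"
  assumes "summable (\<lambda>i. (x i)\<^sup>2)" "summable (\<lambda>i. (y i)\<^sup>2)"
  shows "summable (\<lambda>i. x i * y i)"
proof (rule summable_comparison_test')
  show "summable (\<lambda>i. (x i)\<^sup>2 + (y i)\<^sup>2)"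
    using assms by (rule summable_add)
  show "norm (x i * y i) \<le> (x i)\<^sup>2 + (y i)\<^sup>2" if "0 \<le> i" for i
  proof -
    have "2 * \<bar>x i * y i\<bar> \<le> (x i)\<^sup>2 + (y i)\<^sup>2"
      using sum_squares_bound[of "\<bar>x i\<bar>" "\<bar>y i\<bar>"] by (simp add: abs_mult mult.assoc)
    then show ?thesis
      using abs_ge_zero[of "x i * y i"] unfolding real_norm_def by linarith
  qed
qed

lemma summable_add_sq:
  fixes x y :: "nat \<Rightarrow> real"
  assumes "summable (\<lambda>i. (x i)\<^sup>2)" "summable (\<lambda>i. (y i)\<^sup>2)"
  shows "summable (\<lambda>i. (x i + y i)\<^sup>2)"
proof -
  have "summable (\<lambda>i. (x i)\<^sup>2 + (y i)\<^sup>2 + 2 * (x i * y i))"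
    by (intro summable_add summable_mult summable_mult_if_summable_sq assms)
  then show ?thesis by (simp add: power2_sum mult.assoc)
qed

instantiation ell2 :: real_vector
begin

lift_definition zero_ell2 :: ell2 is "\<lambda>_. 0" by simp

lift_definition plus_ell2 :: "ell2 \<Rightarrow> ell2 \<Rightarrow> ell2" is "\<lambda>x y i. x i + y i"
  by (rule summable_add_sq)

lift_definition uminus_ell2 :: "ell2 \<Rightarrow> ell2" is "\<lambda>x i. - x i" by simp

lift_definition minus_ell2 :: "ell2 \<Rightarrow> ell2 \<Rightarrow> ell2" is "\<lambda>x y i. x i - y i"
  subgoal for x y using summable_add_sq[of x "\<lambda>i. - y i"] by simp
  done

lift_definition scaleR_ell2 :: "real \<Rightarrow> ell2 \<Rightarrow> ell2" is "\<lambda>c x i. c * x i"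
  by (simp add: power_mult_distrib)

instance
  by standard (transfer; simp add: fun_eq_iff algebra_simps)+

end

lemmas coord_simps [simp] =
  zero_ell2.rep_eq plus_ell2.rep_eq uminus_ell2.rep_eq minus_ell2.rep_eq scaleR_ell2.rep_eq

instantiation ell2 :: real_inner
begin

definition inner_ell2 :: "ell2 \<Rightarrow> ell2 \<Rightarrow> real" where
  "inner_ell2 x y = (\<Sum>i. coord x i * coord y i)"

definition norm_ell2 :: "ell2 \<Rightarrow> real" where
  "norm_ell2 x = sqrt (\<Sum>i. (coord x i)\<^sup>2)"

definition dist_ell2 :: "ell2 \<Rightarrow> ell2 \<Rightarrow> real" where
  "dist_ell2 x y = norm (x - y)"

definition sgn_ell2 :: "ell2 \<Rightarrow> ell2" where
  "sgn_ell2 x = x /\<^sub>R norm x"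

definition uniformity_ell2 :: "(ell2 \<times> ell2) filter" where
  "uniformity_ell2 = (INF e\<in>{0<..}. principal {(x, y). dist x y < e})"

definition open_ell2 :: "ell2 set \<Rightarrow> bool" where
  "open_ell2 U \<longleftrightarrow> (\<forall>x\<in>U. eventually (\<lambda>(x', y). x' = x \<longrightarrow> y \<in> U) uniformity)"

instance
proof
  fix x y z :: ell2 and r :: real and U :: "ell2 set"
  have sm: "summable (\<lambda>i. coord u i * coord v i)" for u v
    by (intro summable_mult_if_summable_sq summable_coord_sq)
  show "dist x y = norm (x - y)" by (rule dist_ell2_def)
  show "sgn x = x /\<^sub>R norm x" by (rule sgn_ell2_def)
  show "uniformity = (INF e\<in>{0<..}. principal {(x :: ell2, y). dist x y < e})"
    by (rule uniformity_ell2_def)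
  show "open U \<longleftrightarrow> (\<forall>x\<in>U. eventually (\<lambda>(x', y). x' = x \<longrightarrow> y \<in> U) uniformity)"
    by (rule open_ell2_def)
  show "inner x y = inner y x"
    by (simp add: inner_ell2_def mult.commute)
  show "inner (x + y) z = inner x z + inner y z"
    by (simp add: inner_ell2_def distrib_right suminf_add[OF sm sm])
  show "inner (r *\<^sub>R x) y = r * inner x y"
    by (simp add: inner_ell2_def mult.assoc suminf_mult[OF sm])
  show "0 \<le> inner x x"
    unfolding inner_ell2_def by (intro suminf_nonneg sm) simp
  show "inner x x = 0 \<longleftrightarrow> x = 0"
  proof
    assume "inner x x = 0"
    then have "\<forall>i. coord x i * coord x i = 0"
      unfolding inner_ell2_def by (subst (asm) suminf_eq_zero_iff[OF sm]) auto
    then show "x = 0" by (intro ell2_eqI) simp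
  qed (simp add: inner_ell2_def)
  show "norm x = sqrt (inner x x)"
    by (simp add: norm_ell2_def inner_ell2_def power2_eq_square)
qed

end

lemma sum_coord_sq_le: "(\<Sum>i<n. (coord x i)\<^sup>2) \<le> (norm x)\<^sup>2"
proof -
  have "0 \<le> (\<Sum>i. (coord x i)\<^sup>2)" by (intro suminf_nonneg summable_coord_sq) simp
  then show ?thesis
    by (simp add: norm_ell2_def sum_le_suminf[OF summable_coord_sq])
qed

lemma abs_coord_le_norm: "\<bar>coord x i\<bar> \<le> norm x"
proof (rule power2_le_imp_le)
  have "(coord x i)\<^sup>2 \<le> (\<Sum>j<Suc i. (coord x j)\<^sup>2)"
    by (rule member_le_sum) auto
  also have "\<dots> \<le> (norm x)\<^sup>2" by (rule sum_coord_sq_le)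
  finally show "\<bar>coord x i\<bar>\<^sup>2 \<le> (norm x)\<^sup>2" by simp
qed simp

instance ell2 :: complete_space
proof
  fix X :: "nat \<Rightarrow> ell2"
  assume X: "Cauchy X"
  have "Cauchy (\<lambda>n. coord (X n) i)" for i
  proof (rule metric_CauchyI)
    fix e :: real assume "0 < e"
    then obtain M where M: "\<And>m n. m \<ge> M \<Longrightarrow> n \<ge> M \<Longrightarrow> dist (X m) (X n) < e"
      using metric_CauchyD[OF X] by blast
    have "dist (coord (X m) i) (coord (X n) i) < e" if "m \<ge> M" "n \<ge> M" for m n
      using abs_coord_le_norm[of "X m - X n" i] M[OF that]
      by (simp add: dist_norm)
    then show "\<exists>M. \<forall>m\<ge>M. \<forall>n\<ge>M. dist (coord (X m) i) (coord (X n) i) < e" by blast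
  qed
  then have "\<forall>i. \<exists>l. (\<lambda>n. coord (X n) i) \<longlonglongrightarrow> l"
    by (simp add: Cauchy_convergent_iff convergent_def)
  then obtain l where l: "\<And>i. (\<lambda>n. coord (X n) i) \<longlonglongrightarrow> l i" by metis
  have bound: "\<exists>M. \<forall>n\<ge>M. \<forall>k. (\<Sum>i<k. (coord (X n) i - l i)\<^sup>2) \<le> e\<^sup>2" if e: "0 < e" for e
  proof -
    obtain M where M: "\<And>m n. m \<ge> M \<Longrightarrow> n \<ge> M \<Longrightarrow> dist (X m) (X n) < e"
      using metric_CauchyD[OF X e] by blast
    have "(\<Sum>i<k. (coord (X n) i - l i)\<^sup>2) \<le> e\<^sup>2" if n: "n \<ge> M" for n k
    proof (rule LIMSEQ_le_const2)
      show "(\<lambda>m. \<Sum>i<k. (coord (X n) i - coord (X m) i)\<^sup>2)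
          \<longlonglongrightarrow> (\<Sum>i<k. (coord (X n) i - l i)\<^sup>2)"
        by (intro tendsto_intros l)
      have "(\<Sum>i<k. (coord (X n) i - coord (X m) i)\<^sup>2) \<le> e\<^sup>2" if m: "m \<ge> M" for m
      proof -
        have "(\<Sum>i<k. (coord (X n) i - coord (X m) i)\<^sup>2) \<le> (norm (X n - X m))\<^sup>2"
          using sum_coord_sq_le[of "X n - X m" k] by simp
        also have "\<dots> \<le> e\<^sup>2"
          using M[OF n m] by (intro power_mono) (auto simp: dist_norm)
        finally show ?thesis .
      qed
      then show "\<exists>N. \<forall>m\<ge>N. (\<Sum>i<k. (coord (X n) i - coord (X m) i)\<^sup>2) \<le> e\<^sup>2" by blast
    qed
    then show ?thesis by blast
  qed
  obtain M where "\<And>k. (\<Sum>i<k. (coord (X M) i - l i)\<^sup>2) \<le> 1\<^sup>2"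
    using bound[of 1] by auto
  then have "summable (\<lambda>i. (coord (X M) i - l i)\<^sup>2)"
    by (intro summableI_nonneg_bounded[where x = "1\<^sup>2"]) auto
  then have "summable (\<lambda>i. (l i - coord (X M) i)\<^sup>2)" by (simp add: power2_commute)
  from summable_add_sq[OF this summable_coord_sq[of "X M"]]
  have "summable (\<lambda>i. (l i)\<^sup>2)" by simp
  then have L: "coord (Abs_ell2 l) = l" by (simp add: Abs_ell2_inverse)
  have "X \<longlonglongrightarrow> Abs_ell2 l"
  proof (rule metric_LIMSEQ_I)
    fix e :: real assume "0 < e"
    then obtain M where M: "\<forall>n\<ge>M. \<forall>k. (\<Sum>i<k. (coord (X n) i - l i)\<^sup>2) \<le> (e / 2)\<^sup>2"
      using bound[of "e / 2"] by auto
    have "dist (X n) (Abs_ell2 l) < e" if "n \<ge> M" for n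
    proof -
      have "(\<Sum>i. (coord (X n - Abs_ell2 l) i)\<^sup>2) \<le> (e / 2)\<^sup>2"
        using M that L by (intro suminf_le_const summable_coord_sq) auto
      then have "norm (X n - Abs_ell2 l) \<le> e / 2"
        using \<open>0 < e\<close> unfolding norm_ell2_def by (intro real_le_lsqrt) auto
      then show ?thesis using \<open>0 < e\<close> by (simp add: dist_norm)
    qed
    then show "\<exists>M. \<forall>n\<ge>M. dist (X n) (Abs_ell2 l) < e" by blast
  qed
  then show "convergent X" by (auto simp: convergent_def)
qed

lift_definition unit_ell2 :: "nat \<Rightarrow> ell2" is "\<lambda>i j. if j = i then 1 else 0"
  subgoal for i by (rule summable_finite[of "{i}"]) auto
  done

text \<open>The second argument of \<^const>\<open>normal_density\<close> is the standard deviation, so the factors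
  have variance \<open>(a i)\<^sup>2\<close>.\<close>

definition gauss_product :: "(nat \<Rightarrow> real) \<Rightarrow> (nat \<Rightarrow> real) measure" where
  "gauss_product a = PiM UNIV (\<lambda>i. density lborel (\<lambda>t. ennreal (normal_density 0 (a i) t)))"

text \<open>Square-summable sequences are transported to the type \<^typ>\<open>ell2\<close> by \<^const>\<open>Abs_ell2\<close>;
  the resulting measure lives on the Borel sets of the norm topology.\<close>

definition gauss_ell2 :: "(nat \<Rightarrow> real) \<Rightarrow> ell2 measure" where
  "gauss_ell2 a =
     distr (restrict_space (gauss_product a) {x. summable (\<lambda>i. (x i)\<^sup>2)}) borel Abs_ell2"

definition gauss_conv :: "(nat \<Rightarrow> real) \<Rightarrow> (ell2 \<Rightarrow> real) \<Rightarrow> ell2 \<Rightarrow> real" where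
  "gauss_conv a f x = (\<integral>y. f (x + y) \<partial>gauss_ell2 a)"

definition partial_deriv :: "nat \<Rightarrow> (ell2 \<Rightarrow> real) \<Rightarrow> ell2 \<Rightarrow> real" where
  "partial_deriv i g x = deriv (\<lambda>t. g (x + t *\<^sub>R unit_ell2 i)) 0"

end

theory Submission imports Defs begin

text \<open>Differentiating the Gaussian weight instead of \<open>f\<close>, one finds that \<open>a\<^sub>i D\<^sub>i(p\<^sub>1 f)(x)\<close> is the
  inner product of \<open>f(x + \<cdot>)\<close> with the \<open>i\<close>-th normalised coordinate \<open>y\<^sub>i / a\<^sub>i\<close> in \<open>L\<^sup>2(P)\<close>.
  These coordinates are orthonormal, so Bessel's inequality bounds the sum of squares by
  \<open>(sup |f|)\<^sup>2\<close>, and larger exponents follow because each single term is bounded.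
  For \<open>p < 2\<close> the functions \<open>sin (\<Sum>i<n. x\<^sub>i / (a\<^sub>i \<surd>n))\<close> all have supremum \<open>1\<close>, while each of the
  first \<open>n\<close> normalised derivatives at \<open>0\<close> equals \<open>exp (-1/2) / \<surd>n\<close>; the sum is of order
  \<open>n\<close> to the power \<open>1 - p/2\<close>, hence unbounded.\<close>

section \<open>One-dimensional Gaussian integrals: translation, exponential moments,
  differentiation\<close>

abbreviation gauss_real :: "real \<Rightarrow> real measure" where
  "gauss_real s \<equiv> density lborel (\<lambda>t. ennreal (normal_density 0 s t))"

lemma normal_density_shift:
  "normal_density 0 s (u - t) = normal_density 0 s u * exp ((t * u - t\<^sup>2 / 2) / s\<^sup>2)"
proof -
  have "- (u - t)\<^sup>2 / (2 * s\<^sup>2) = - u\<^sup>2 / (2 * s\<^sup>2) + (t * u - t\<^sup>2 / 2) / s\<^sup>2"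
    by (cases "s = 0") (simp_all add: power2_eq_square field_simps)
  then show ?thesis
    by (simp add: normal_density_def mult.assoc flip: exp_add)
qed

lemma integral_gauss_real:
  fixes g :: "real \<Rightarrow> real"
  assumes [measurable]: "g \<in> borel_measurable borel"
  shows "(\<integral>u. g u \<partial>gauss_real s) = (\<integral>u. normal_density 0 s u * g u \<partial>lborel)"
  by (subst integral_real_density) auto

text \<open>A substitution in Lebesgue measure moves the shift onto the Gaussian weight, producing
  the Cameron-Martin factor. The parameter \<open>t\<close> then occurs only in a smooth function,
  so differentiation in \<open>t\<close> asks no regularity of \<open>\<phi>\<close>.\<close>

lemma integral_gauss_real_shift:
  fixes \<phi> :: "real \<Rightarrow> real"
  assumes [measurable]: "\<phi> \<in> borel_measurable borel"
  shows "(\<integral>u. \<phi> (u + t) \<partial>gauss_real s) =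
    (\<integral>u. exp ((t * u - t\<^sup>2 / 2) / s\<^sup>2) * \<phi> u \<partial>gauss_real s)"
proof -
  have "(\<integral>u. \<phi> (u + t) \<partial>gauss_real s) = (\<integral>u. normal_density 0 s u * \<phi> (u + t) \<partial>lborel)"
    by (simp add: integral_gauss_real)
  also have "\<dots> = (\<integral>u. normal_density 0 s (u - t) * \<phi> u \<partial>lborel)"
    by (subst lborel_integral_real_affine[where c = 1 and t = "- t"]) auto
  also have "\<dots> = (\<integral>u. exp ((t * u - t\<^sup>2 / 2) / s\<^sup>2) * \<phi> u \<partial>gauss_real s)"
    by (simp add: integral_gauss_real normal_density_shift mult.assoc)
  finally show ?thesis .
qed

lemma integrable_gauss_real_exp_abs:
  fixes k :: real
  assumes s: "0 < s"
  shows "integrable (gauss_real s) (\<lambda>u. exp (k * \<bar>u\<bar>))"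
proof -
  have *: "integrable (gauss_real s) (\<lambda>u. exp (c * u))" for c
  proof -
    \<comment> \<open>Completing the square: tilting a centered normal density by an exponential
      gives a constant multiple of its translate by \<open>c * s\<^sup>2\<close>.\<close>
    have "normal_density 0 s u * exp (c * u) =
        exp (c\<^sup>2 * s\<^sup>2 / 2) * normal_density 0 s (u - c * s\<^sup>2)" for u
    proof -
      have "c * s\<^sup>2 * u / s\<^sup>2 - (c * s\<^sup>2)\<^sup>2 / 2 / s\<^sup>2 = c * u - c\<^sup>2 * s\<^sup>2 / 2"
        using s by (simp add: power2_eq_square)
      then show ?thesis
        by (simp add: normal_density_shift diff_divide_distrib exp_diff mult_ac)
    qed
    moreover have "integrable lborel (\<lambda>u. normal_density 0 s (u - c * s\<^sup>2))"
      using lborel_integrable_real_affine[OF integrable_normal_density[OF s, of 0], of 1 "- (c * s\<^sup>2)"]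
      by simp
    ultimately show ?thesis
      by (subst integrable_real_density) auto
  qed
  show ?thesis
  proof (rule Bochner_Integration.integrable_bound)
    show "integrable (gauss_real s) (\<lambda>u. exp (k * u) + exp (- k * u))"
      by (intro Bochner_Integration.integrable_add *)
    show "AE u in gauss_real s. norm (exp (k * \<bar>u\<bar>)) \<le> norm (exp (k * u) + exp (- k * u))"
    proof (intro AE_I2)
      show "norm (exp (k * \<bar>u\<bar>)) \<le> norm (exp (k * u) + exp (- k * u))" for u
        using exp_gt_zero[of "k * u"] exp_gt_zero[of "- k * u"] by (cases "0 \<le> u") auto
    qed
  qed simp
qed

text \<open>With the shift moved to the weight, the difference quotients of \<open>e t u\<close> at
  \<open>t = 0\<close> converge to \<open>u / s\<^sup>2\<close>, and an integrable exponential bound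
  for \<open>\<bar>t\<bar> \<le> 1\<close> permits dominated convergence.\<close>

lemma has_derivative_gauss_real_shift:
  fixes \<phi> :: "real \<Rightarrow> real"
  assumes [measurable]: "\<phi> \<in> borel_measurable borel"
    and B: "\<And>u. \<bar>\<phi> u\<bar> \<le> B" and s: "0 < s"
  shows "((\<lambda>t. \<integral>u. \<phi> (u + t) \<partial>gauss_real s) has_real_derivative
    (\<integral>u. \<phi> u * u \<partial>gauss_real s) / s\<^sup>2) (at 0)"
proof -
  let ?N = "gauss_real s"
  interpret N: prob_space ?N using s by (rule prob_space_normal_density)
  define e where "e t u = exp ((t * u - t\<^sup>2 / 2) / s\<^sup>2)" for t u :: real
  \<comment> \<open>The two summands pay for the two factors estimated in \<open>eb\<close>:
    \<open>e t u\<close> is at most \<open>exp (\<bar>u\<bar> / s\<^sup>2)\<close>, and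
    \<open>\<bar>u - t\<bar>\<close> is at most \<open>exp \<bar>u\<bar>\<close>.\<close>
  define k where "k = 1 / s\<^sup>2 + 1"
  have [measurable]: "e t \<in> borel_measurable borel" for t unfolding e_def by simp
  have e0: "e 0 u = 1" for u by (simp add: e_def)
  have B0: "0 \<le> B" using B[of 0] by linarith
  have de: "((\<lambda>t. e t u) has_real_derivative e t u * ((u - t) / s\<^sup>2)) (at t within S)" for t u S
    unfolding e_def using s
    by (auto intro!: derivative_eq_intros simp: field_simps power2_eq_square)
  have eb: "\<bar>e t u * ((u - t) / s\<^sup>2)\<bar> \<le> exp (k * \<bar>u\<bar>) / s\<^sup>2" if t: "\<bar>t\<bar> \<le> 1" for t u
  proof -
    have "t * u \<le> \<bar>u\<bar>"
      using t mult_right_mono[of "\<bar>t\<bar>" 1 "\<bar>u\<bar>"] abs_ge_self[of "t * u"] by (simp add: abs_mult)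
    then have "t * u - t\<^sup>2 / 2 \<le> \<bar>u\<bar>" by (smt (verit) zero_le_power2 field_sum_of_halves)
    then have "e t u \<le> exp (\<bar>u\<bar> / s\<^sup>2)"
      unfolding e_def by (simp add: divide_right_mono)
    moreover have "\<bar>u - t\<bar> \<le> exp \<bar>u\<bar>"
      using t exp_ge_add_one_self[of "\<bar>u\<bar>"] by linarith
    ultimately have "e t u * \<bar>u - t\<bar> \<le> exp (\<bar>u\<bar> / s\<^sup>2) * exp \<bar>u\<bar>"
      by (intro mult_mono) auto
    also have "\<dots> = exp (k * \<bar>u\<bar>)" by (simp add: k_def field_simps flip: exp_add)
    finally have "e t u * \<bar>u - t\<bar> / s\<^sup>2 \<le> exp (k * \<bar>u\<bar>) / s\<^sup>2" by (rule divide_right_mono) simp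
    moreover have "0 \<le> e t u" by (simp add: e_def)
    ultimately show ?thesis by (simp add: abs_mult)
  qed
  have quot: "\<bar>(e t u - 1) / t\<bar> \<le> exp (k * \<bar>u\<bar>) / s\<^sup>2" if t: "\<bar>t\<bar> \<le> 1" "t \<noteq> 0" for t u
  proof -
    \<comment> \<open>Mean value inequality: the derivative bound \<open>eb\<close> is uniform on
      \<open>{-1..1}\<close> and so passes to the difference quotients.\<close>
    have "norm (e t u - e 0 u) \<le> exp (k * \<bar>u\<bar>) / s\<^sup>2 * norm (t - 0)"
    proof (rule field_differentiable_bound[where S = "{-1..1}", OF _ de])
      show "norm (e z u * ((u - z) / s\<^sup>2)) \<le> exp (k * \<bar>u\<bar>) / s\<^sup>2" if "z \<in> {-1..1}" for z
        using eb[of z u] that by (simp add: abs_le_iff)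
    qed (use t in auto)
    then show ?thesis using t s by (simp add: e0 divide_simps)
  qed
  have int_exp: "integrable ?N (\<lambda>u. exp (k * \<bar>u\<bar>) / s\<^sup>2)" for k
    by (intro Bochner_Integration.integrable_divide integrable_gauss_real_exp_abs s)
  have int_e: "integrable ?N (\<lambda>u. e t u * \<phi> u)" for t
  proof (rule Bochner_Integration.integrable_bound)
    show "integrable ?N (\<lambda>u. B * exp ((\<bar>t\<bar> / s\<^sup>2) * \<bar>u\<bar>))"
      by (intro Bochner_Integration.integrable_mult_right integrable_gauss_real_exp_abs s)
    have "norm (e t u * \<phi> u) \<le> norm (B * exp ((\<bar>t\<bar> / s\<^sup>2) * \<bar>u\<bar>))" for u
    proof -
      have "t * u \<le> \<bar>t\<bar> * \<bar>u\<bar>" using abs_ge_self[of "t * u"] by (simp add: abs_mult)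
      then have "t * u - t\<^sup>2 / 2 \<le> \<bar>t\<bar> * \<bar>u\<bar>" by (smt (verit) zero_le_power2 field_sum_of_halves)
      then have "e t u \<le> exp (\<bar>t\<bar> / s\<^sup>2 * \<bar>u\<bar>)"
        unfolding e_def by (simp add: divide_right_mono)
      then have "e t u * \<bar>\<phi> u\<bar> \<le> exp (\<bar>t\<bar> / s\<^sup>2 * \<bar>u\<bar>) * B"
        using B by (intro mult_mono) auto
      moreover have "0 \<le> e t u" by (simp add: e_def)
      ultimately show ?thesis using B0 by (simp add: abs_mult mult.commute)
    qed
    then show "AE u in ?N. norm (e t u * \<phi> u) \<le> norm (B * exp ((\<bar>t\<bar> / s\<^sup>2) * \<bar>u\<bar>))"
      by (intro AE_I2)
  qed simp
  \<comment> \<open>Approaching 0 within the unit ball keeps \<open>t\<close> where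
    \<open>quot\<close> applies; the ball is open, so the limit is the unrestricted one.\<close>
  have "((\<lambda>t. \<integral>u. (e t u - 1) / t * \<phi> u \<partial>?N) \<longlongrightarrow> (\<integral>u. u / s\<^sup>2 * \<phi> u \<partial>?N))
      (at 0 within ball 0 1)"
    unfolding tendsto_at_iff_sequentially
  proof (intro allI impI, unfold comp_def)
    fix X :: "nat \<Rightarrow> real"
    assume X: "\<forall>i. X i \<in> ball 0 1 - {0}" and X0: "X \<longlonglongrightarrow> 0"
    show "(\<lambda>n. \<integral>u. (e (X n) u - 1) / X n * \<phi> u \<partial>?N) \<longlonglongrightarrow> (\<integral>u. u / s\<^sup>2 * \<phi> u \<partial>?N)"
    proof (rule integral_dominated_convergence)
      show "integrable ?N (\<lambda>u. exp (k * \<bar>u\<bar>) / s\<^sup>2 * B)"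
        by (intro Bochner_Integration.integrable_mult_left int_exp)
      have "(\<lambda>n. (e (X n) u - 1) / X n * \<phi> u) \<longlonglongrightarrow> u / s\<^sup>2 * \<phi> u" for u
      proof (intro tendsto_mult tendsto_const)
        have "((\<lambda>t. (e t u - 1) / t) \<longlongrightarrow> u / s\<^sup>2) (at 0)"
          using de[of u 0 UNIV] by (simp add: has_field_derivative_iff e0)
        then show "(\<lambda>n. (e (X n) u - 1) / X n) \<longlonglongrightarrow> u / s\<^sup>2"
          using X X0 by (auto simp: tendsto_at_iff_sequentially comp_def)
      qed
      then show "AE u in ?N. (\<lambda>n. (e (X n) u - 1) / X n * \<phi> u) \<longlonglongrightarrow> u / s\<^sup>2 * \<phi> u"
        by (intro AE_I2)
      fix n
      have "norm ((e (X n) u - 1) / X n * \<phi> u) \<le> exp (k * \<bar>u\<bar>) / s\<^sup>2 * B" for u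
        using X[rule_format, of n] quot[of "X n" u] B[of u]
        unfolding real_norm_def abs_mult by (intro mult_mono) auto
      then show "AE u in ?N. norm ((e (X n) u - 1) / X n * \<phi> u) \<le> exp (k * \<bar>u\<bar>) / s\<^sup>2 * B"
        by (intro AE_I2)
    qed auto
  qed
  then have L: "((\<lambda>t. \<integral>u. (e t u - 1) / t * \<phi> u \<partial>?N) \<longlongrightarrow> (\<integral>u. u / s\<^sup>2 * \<phi> u \<partial>?N)) (at 0)"
    by (subst (asm) at_within_open) auto
  have Q: "(\<integral>u. (e t u - 1) / t * \<phi> u \<partial>?N) =
      ((\<integral>u. e t u * \<phi> u \<partial>?N) - (\<integral>u. e 0 u * \<phi> u \<partial>?N)) / (t - 0)" for t
  proof -
    have "(\<integral>u. e t u * \<phi> u \<partial>?N) - (\<integral>u. e 0 u * \<phi> u \<partial>?N) = (\<integral>u. e t u * \<phi> u - e 0 u * \<phi> u \<partial>?N)"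
      by (rule Bochner_Integration.integral_diff[symmetric]) (rule int_e)+
    also have "\<dots> / (t - 0) = (\<integral>u. (e t u - 1) / t * \<phi> u \<partial>?N)"
      by (subst integral_divide_zero[symmetric]) (simp add: e0 field_simps)
    finally show ?thesis ..
  qed
  have R: "(\<integral>u. u / s\<^sup>2 * \<phi> u \<partial>?N) = (\<integral>u. \<phi> u * u \<partial>?N) / s\<^sup>2"
    by (subst integral_divide_zero[symmetric]) (simp add: field_simps)
  show ?thesis
    using L unfolding has_field_derivative_iff integral_gauss_real_shift[OF assms(1)]
      e_def[symmetric] Q R .
qed

text \<open>The sine is the imaginary part of \<open>iexp u * iexp s\<close>, and the characteristic
  function of the standard normal law at 1 is \<open>exp (- 1 / 2)\<close>.\<close>

lemma integral_std_normal_sin_shift: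
  "(\<integral>u. std_normal_density u * sin (u + s) \<partial>lborel) = exp (- 1 / 2) * sin s"
proof -
  let ?M = "density lborel (\<lambda>x. ennreal (std_normal_density x))"
  interpret M: prob_space ?M by (rule prob_space_normal_density) simp
  have int: "integrable ?M (\<lambda>u. iexp u)"
    by (rule M.integrable_const_bound[of _ 1]) auto
  have "(\<integral>u. iexp u \<partial>?M) = complex_of_real (exp (- 1 / 2))"
    using fun_cong[OF char_std_normal_distribution, of 1] by (simp add: char_def)
  then have "(\<integral>u. iexp u * iexp s \<partial>?M) = complex_of_real (exp (- 1 / 2)) * iexp s"
    by (subst integral_mult_left_zero) simp
  then have "Im (\<integral>u. iexp u * iexp s \<partial>?M) = exp (- 1 / 2) * sin s"
    by (simp add: Im_exp)
  moreover have "Im (\<integral>u. iexp u * iexp s \<partial>?M) = (\<integral>u. Im (iexp u * iexp s) \<partial>?M)"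
    by (rule integral_Im[symmetric]) (use int in auto)
  moreover have "Im (iexp u * iexp s) = sin (u + s)" for u
    by (simp add: Im_exp Re_exp sin_add)
  ultimately have "(\<integral>u. sin (u + s) \<partial>?M) = exp (- 1 / 2) * sin s"
    by simp
  then show ?thesis by (subst (asm) integral_real_density) auto
qed

section \<open>The Gaussian product measure and its transport to square-summable sequences\<close>

lemma sets_gauss_product: "sets (gauss_product a) = sets borel"
proof -
  have "sets (gauss_product a) = sets (PiM UNIV (\<lambda>_. borel))"
    unfolding gauss_product_def by (intro sets_PiM_cong) auto
  then show ?thesis by (simp add: sets_PiM_equal_borel)
qed

lemma measurable_gauss_product: "measurable (gauss_product a) N = measurable borel N"
  by (intro measurable_cong_sets sets_gauss_product refl)

lemma measurable_coordinate [measurable]: "(\<lambda>\<omega> :: nat \<Rightarrow> real. \<omega> i) \<in> borel_measurable borel"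
  by (intro borel_measurable_continuous_onI continuous_on_product_coordinates)

definition sq_summable :: "(nat \<Rightarrow> real) set" where
  "sq_summable = {x. summable (\<lambda>i. (x i)\<^sup>2)}"

lemma coord_Abs_ell2: "\<omega> \<in> sq_summable \<Longrightarrow> coord (Abs_ell2 \<omega>) = \<omega>"
  by (simp add: sq_summable_def Abs_ell2_inverse)

text \<open>In \<open>ennreal\<close> the series always has a value, so membership becomes
  finiteness of a measurable function. This yields measurability of the set and later its full
  measure.\<close>

lemma sq_summable_iff: "\<omega> \<in> sq_summable \<longleftrightarrow> (\<Sum>i. ennreal ((\<omega> i)\<^sup>2)) \<noteq> \<infinity>"
  unfolding sq_summable_def mem_Collect_eq infinity_ennreal_def
proof
  show "summable (\<lambda>i. (\<omega> i)\<^sup>2) \<Longrightarrow> (\<Sum>i. ennreal ((\<omega> i)\<^sup>2)) \<noteq> top"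
    by (intro ennreal_suminf_neq_top) auto
  show "(\<Sum>i. ennreal ((\<omega> i)\<^sup>2)) \<noteq> top \<Longrightarrow> summable (\<lambda>i. (\<omega> i)\<^sup>2)"
    by (rule summable_suminf_not_top) auto
qed

lemma sets_sq_summable [measurable]: "sq_summable \<in> sets borel"
proof -
  have "sq_summable = {\<omega> \<in> space borel. (\<Sum>i. ennreal ((\<omega> i)\<^sup>2)) \<noteq> \<infinity>}"
    by (auto simp: sq_summable_iff)
  also have "\<dots> \<in> sets borel" by measurable
  finally show ?thesis .
qed

lemma coord_sum: "coord (\<Sum>i\<in>I. x i) j = (\<Sum>i\<in>I. coord (x i) j)"
  by (induction I rule: infinite_finite_induct) auto

text \<open>The norm of the error is the square root of a tail of the convergent series of
  squares.\<close>

lemma tendsto_unit_ell2_sum: "(\<lambda>n. \<Sum>i<n. coord x i *\<^sub>R unit_ell2 i) \<longlonglongrightarrow> x"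
proof -
  let ?T = "\<lambda>n. \<Sum>i<n. coord x i *\<^sub>R unit_ell2 i"
  have *: "norm (?T n - x) = sqrt ((\<Sum>i. (coord x i)\<^sup>2) - (\<Sum>i<n. (coord x i)\<^sup>2))" for n
  proof -
    let ?h = "\<lambda>j. if j < n then (coord x j)\<^sup>2 else 0"
    have h: "?h sums (\<Sum>i<n. (coord x i)\<^sup>2)"
      using sums_If_finite_set[of "{..<n}" "\<lambda>j. (coord x j)\<^sup>2"] by simp
    have "(coord (?T n - x) j)\<^sup>2 = (coord x j)\<^sup>2 - ?h j" for j
      by (simp add: coord_sum unit_ell2.rep_eq if_distrib[of "(*) _"] sum.delta cong: if_cong)
    then have "(\<Sum>j. (coord (?T n - x) j)\<^sup>2) = (\<Sum>i. (coord x i)\<^sup>2) - (\<Sum>i<n. (coord x i)\<^sup>2)"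
      using sums_diff[OF summable_sums[OF summable_coord_sq] h] by (simp add: sums_iff)
    then show ?thesis by (simp add: norm_ell2_def)
  qed
  have "(\<lambda>n. norm (?T n - x)) \<longlonglongrightarrow> sqrt ((\<Sum>i. (coord x i)\<^sup>2) - (\<Sum>i. (coord x i)\<^sup>2))"
    unfolding * by (intro tendsto_intros summable_LIMSEQ summable_coord_sq)
  then show ?thesis by (simp add: LIM_zero_iff tendsto_norm_zero_iff)
qed

text \<open>The finite partial sums factor continuously through the product topology on sequences, whose
  Borel sets are the product sigma-algebra, so separability of \<^typ>\<open>ell2\<close> is not needed.\<close>

lemma measurable_Abs_ell2:
  "Abs_ell2 \<in> measurable (restrict_space borel sq_summable) borel"
proof (rule borel_measurable_LIMSEQ_metric)
  fix n
  have "(\<lambda>\<omega>. \<Sum>i<n. \<omega> i *\<^sub>R unit_ell2 i) \<in> borel_measurable borel"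
    by (intro borel_measurable_continuous_onI continuous_intros continuous_on_product_coordinates)
  then show "(\<lambda>\<omega>. \<Sum>i<n. \<omega> i *\<^sub>R unit_ell2 i) \<in>
      measurable (restrict_space borel sq_summable) borel"
    by (rule measurable_restrict_space1)
next
  fix \<omega> assume "\<omega> \<in> space (restrict_space borel sq_summable)"
  then have "\<omega> \<in> sq_summable" by (simp add: space_restrict_space)
  then show "(\<lambda>n. \<Sum>i<n. \<omega> i *\<^sub>R unit_ell2 i) \<longlonglongrightarrow> Abs_ell2 \<omega>"
    using tendsto_unit_ell2_sum[of "Abs_ell2 \<omega>"] by (simp add: coord_Abs_ell2)
qed

text \<open>Off the square-summable sequences \<^const>\<open>Abs_ell2\<close> is unspecified, hence the indicator.\<close>

definition translate :: "(ell2 \<Rightarrow> real) \<Rightarrow> ell2 \<Rightarrow> (nat \<Rightarrow> real) \<Rightarrow> real" where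
  "translate f x \<omega> = indicator sq_summable \<omega> *\<^sub>R f (x + Abs_ell2 \<omega>)"

lemma measurable_shift_ell2:
  fixes f :: "ell2 \<Rightarrow> real"
  assumes "f \<in> borel_measurable borel"
  shows "(\<lambda>y. f (x + y)) \<in> borel_measurable borel"
proof -
  have "(\<lambda>y. x + y) \<in> borel_measurable borel"
    by (intro borel_measurable_continuous_onI continuous_intros)
  from measurable_compose[OF this assms] show ?thesis .
qed

lemma measurable_translate [measurable]:
  assumes "f \<in> borel_measurable borel"
  shows "translate f x \<in> borel_measurable borel"
  using measurable_compose[OF measurable_Abs_ell2 measurable_shift_ell2[OF assms, of x]]
  by (subst (asm) borel_measurable_restrict_space_iff) (auto simp: translate_def[abs_def])

lemma abs_translate_le:
  assumes B: "\<And>y. \<bar>f y\<bar> \<le> B"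
  shows "\<bar>translate f x \<omega>\<bar> \<le> B"
  using B[of 0] B by (auto simp: translate_def indicator_def intro: order_trans[OF abs_ge_zero])

text \<open>Pulls the convolution back to the full product space, where independence and Fubini in a
  single coordinate are available; the restriction of the measure turns into the indicator inside
  \<open>translate\<close>.\<close>

lemma gauss_conv_eq_integral:
  assumes "f \<in> borel_measurable borel"
  shows "gauss_conv a f x = (\<integral>\<omega>. translate f x \<omega> \<partial>gauss_product a)"
proof -
  have "Abs_ell2 \<in> measurable (restrict_space (gauss_product a) sq_summable) borel"
    using measurable_Abs_ell2
    by (simp cong: measurable_cong_sets add: sets_restrict_space_cong[OF sets_gauss_product])
  then have "gauss_conv a f x =
      (\<integral>\<omega>. f (x + Abs_ell2 \<omega>) \<partial>restrict_space (gauss_product a) sq_summable)"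
    unfolding gauss_conv_def gauss_ell2_def sq_summable_def
    by (intro integral_distr measurable_shift_ell2 assms)
  also have "\<dots> = (\<integral>\<omega>. translate f x \<omega> \<partial>gauss_product a)"
    unfolding translate_def
    by (intro integral_restrict_space) (simp add: sets_gauss_product)
  finally show ?thesis .
qed

text \<open>Altering one coordinate does not affect square-summability, so the indicator is
  unchanged and a step along a unit vector becomes a shift of one real variable.\<close>

lemma translate_unit_ell2:
  "translate f (x + t *\<^sub>R unit_ell2 i) \<omega> = translate f x (fun_upd \<omega> i (\<omega> i + t))"
proof -
  have "summable (\<lambda>j. (fun_upd \<omega> i (\<omega> i + t) j)\<^sup>2) = summable (\<lambda>j. (\<omega> j)\<^sup>2)"
    by (intro summable_cong eventually_sequentiallyI[of "Suc i"]) simp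
  then have S: "fun_upd \<omega> i (\<omega> i + t) \<in> sq_summable \<longleftrightarrow> \<omega> \<in> sq_summable"
    by (simp add: sq_summable_def)
  have "x + t *\<^sub>R unit_ell2 i + Abs_ell2 \<omega> = x + Abs_ell2 (fun_upd \<omega> i (\<omega> i + t))"
    if "\<omega> \<in> sq_summable"
    using that S by (intro ell2_eqI) (simp add: coord_Abs_ell2 unit_ell2.rep_eq)
  then show ?thesis
    by (cases "\<omega> \<in> sq_summable") (simp_all add: translate_def S add.assoc)
qed

section \<open>Second moments, independence and linear combinations of the Gaussian
  coordinates\<close>

lemma (in prob_space) centered_normal_second_moment:
  assumes s: "0 < s" and D: "distributed M lborel X (\<lambda>t. ennreal (normal_density 0 s t))"
  shows "integrable M (\<lambda>\<omega>. (X \<omega>)\<^sup>2)" "expectation (\<lambda>\<omega>. (X \<omega>)\<^sup>2) = s\<^sup>2"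
proof -
  have "has_bochner_integral lborel (\<lambda>t. normal_density 0 s t * t\<^sup>2) (s\<^sup>2)"
    using normal_moment_even[OF s, of 0 1] by (simp add: eval_nat_numeral)
  then show "integrable M (\<lambda>\<omega>. (X \<omega>)\<^sup>2)" "expectation (\<lambda>\<omega>. (X \<omega>)\<^sup>2) = s\<^sup>2"
    using distributed_integrable[OF D, of power2] distributed_integral[OF D, of power2]
    by (auto simp: has_bochner_integral_iff)
qed

locale gauss_seq =
  fixes a :: "nat \<Rightarrow> real"
  assumes a_pos: "0 < a i"
begin

abbreviation \<mu> :: "(nat \<Rightarrow> real) measure" where "\<mu> \<equiv> gauss_product a"

lemma prob_space_factor: "prob_space (gauss_real (a i))"
  by (intro prob_space_normal_density a_pos)

sublocale prob_space \<mu>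
  unfolding gauss_product_def by (intro prob_space_PiM prob_space_factor)

lemmas [measurable_cong] = sets_gauss_product[of a]

lemma distr_coordinate: "distr \<mu> borel (\<lambda>\<omega>. \<omega> i) = gauss_real (a i)"
proof -
  have "distr \<mu> borel (\<lambda>\<omega>. \<omega> i) = distr \<mu> (gauss_real (a i)) (\<lambda>\<omega>. \<omega> i)"
    by (intro distr_cong) auto
  also have "\<dots> = gauss_real (a i)"
    unfolding gauss_product_def by (intro distr_PiM_component prob_space_factor) auto
  finally show ?thesis .
qed

lemma distributed_coordinate:
  "distributed \<mu> lborel (\<lambda>\<omega>. \<omega> i) (\<lambda>t. ennreal (normal_density 0 (a i) t))"
  unfolding distributed_def
proof (intro conjI)
  have "distr \<mu> lborel (\<lambda>\<omega>. \<omega> i) = distr \<mu> borel (\<lambda>\<omega>. \<omega> i)"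
    by (intro distr_cong) auto
  then show "distr \<mu> lborel (\<lambda>\<omega>. \<omega> i) = gauss_real (a i)"
    by (simp add: distr_coordinate)
qed auto

text \<open>The joint law of the coordinates is the law of the identity map, that is, the product
  measure itself.\<close>

lemma indep_coordinates: "indep_vars (\<lambda>_. borel) (\<lambda>i \<omega>. \<omega> i) UNIV"
proof (subst indep_vars_iff_distr_eq_PiM)
  have "distr \<mu> (PiM UNIV (\<lambda>_. borel)) (\<lambda>\<omega>. \<lambda>i\<in>UNIV. \<omega> i) = distr \<mu> \<mu> (\<lambda>\<omega>. \<omega>)"
    by (intro distr_cong) (auto simp: sets_PiM_equal_borel sets_gauss_product)
  also have "\<dots> = (\<Pi>\<^sub>M i\<in>UNIV. distr \<mu> borel (\<lambda>\<omega>. \<omega> i))"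
    unfolding distr_coordinate by (simp add: gauss_product_def)
  finally show "distr \<mu> (PiM UNIV (\<lambda>_. borel)) (\<lambda>\<omega>. \<lambda>i\<in>UNIV. \<omega> i) =
      (\<Pi>\<^sub>M i\<in>UNIV. distr \<mu> borel (\<lambda>\<omega>. \<omega> i))" .
qed auto

text \<open>Sums of independent normals are normal with added variances. Nonzero coefficients and a
  nonempty index set keep the law nondegenerate, so that it has a density.\<close>

lemma distributed_linear_combination:
  assumes I: "finite I" "I \<noteq> {}" and c: "\<And>i. i \<in> I \<Longrightarrow> c i \<noteq> 0"
  shows "distributed \<mu> lborel (\<lambda>\<omega>. \<Sum>i\<in>I. c i * \<omega> i)
    (\<lambda>t. ennreal (normal_density 0 (sqrt (\<Sum>i\<in>I. (c i * a i)\<^sup>2)) t))"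
proof -
  have "indep_vars (\<lambda>_. borel) (\<lambda>i \<omega>. c i * \<omega> i) I"
    by (intro indep_vars_compose2[OF indep_vars_subset[OF indep_coordinates]]) auto
  moreover have "distributed \<mu> lborel (\<lambda>\<omega>. c i * \<omega> i)
      (\<lambda>t. ennreal (normal_density 0 (\<bar>c i\<bar> * a i) t))" if "i \<in> I" for i
    using normal_density_affine[OF distributed_coordinate[of i] a_pos c[OF that], of 0] by simp
  ultimately show ?thesis
    using sum_indep_normal[OF I, of "\<lambda>i \<omega>. c i * \<omega> i" "\<lambda>i. \<bar>c i\<bar> * a i" "\<lambda>_. 0"] a_pos c
    by (simp add: power_mult_distrib)
qed


text \<open>The expected sum of squares is the sum of the variances \<open>(a i)\<^sup>2\<close>,
  which is finite because \<open>a i \<le> suminf a\<close>; a nonnegative function with finite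
  integral is finite almost everywhere.\<close>

lemma AE_sq_summable:
  assumes "summable a"
  shows "AE \<omega> in \<mu>. \<omega> \<in> sq_summable"
proof -
  note moment = centered_normal_second_moment[OF a_pos distributed_coordinate]
  have "summable (\<lambda>i. (a i)\<^sup>2)"
  proof (rule summable_comparison_test')
    show "summable (\<lambda>i. suminf a * a i)" using assms by (rule summable_mult)
    have "a i \<le> suminf a" for i
      using sum_le_suminf[OF assms, of "{i}"] a_pos by (simp add: less_imp_le)
    then show "norm ((a i)\<^sup>2) \<le> suminf a * a i" if "0 \<le> i" for i
      using a_pos[of i] by (simp add: power2_eq_square)
  qed
  have "(\<integral>\<^sup>+\<omega>. (\<Sum>i. ennreal ((\<omega> i)\<^sup>2)) \<partial>\<mu>) = (\<Sum>i. \<integral>\<^sup>+\<omega>. ennreal ((\<omega> i)\<^sup>2) \<partial>\<mu>)"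
    by (intro nn_integral_suminf) measurable
  also have "\<dots> = (\<Sum>i. ennreal ((a i)\<^sup>2))"
    using moment by (simp add: nn_integral_eq_integral)
  also have "\<dots> \<noteq> \<infinity>"
    unfolding infinity_ennreal_def
    by (rule ennreal_suminf_neq_top) (use \<open>summable (\<lambda>i. (a i)\<^sup>2)\<close> in auto)
  finally have "AE \<omega> in \<mu>. (\<Sum>i. ennreal ((\<omega> i)\<^sup>2)) \<noteq> \<infinity>"
    by (intro nn_integral_PInf_AE) auto
  then show ?thesis by (simp add: sq_summable_iff)
qed

section \<open>Integrating out all coordinates but one; the derivative formula and Bessel's
  inequality\<close>

definition marginal :: "nat \<Rightarrow> ((nat \<Rightarrow> real) \<Rightarrow> real) \<Rightarrow> real \<Rightarrow> real" where
  "marginal i G u = (\<integral>X. G (fun_upd X i u) \<partial>PiM (- {i}) (\<lambda>j. gauss_real (a j)))"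

text \<open>\<open>marginal i G u\<close> is the conditional expectation of \<open>G\<close> given
  that coordinate \<open>i\<close> equals \<open>u\<close>, and the integral formula is Fubini for
  this splitting. The factor \<open>h\<close> is only assumed integrable, so that it may be the
  unbounded identity.\<close>

lemma
  fixes G :: "(nat \<Rightarrow> real) \<Rightarrow> real" and h :: "real \<Rightarrow> real"
  assumes G: "G \<in> borel_measurable borel" and B: "\<And>\<omega>. \<bar>G \<omega>\<bar> \<le> B"
  shows measurable_marginal: "marginal i G \<in> borel_measurable borel"
    and abs_marginal_le: "\<bar>marginal i G u\<bar> \<le> B"
    and integral_marginal: "integrable (gauss_real (a i)) h \<Longrightarrow>
      (\<integral>\<omega>. G \<omega> * h (\<omega> i) \<partial>\<mu>) = (\<integral>u. marginal i G u * h u \<partial>gauss_real (a i))"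
proof -
  let ?N = "gauss_real (a i)" and ?P = "PiM (- {i}) (\<lambda>j. gauss_real (a j))"
  interpret N: prob_space ?N by (rule prob_space_factor)
  interpret P: prob_space ?P by (intro prob_space_PiM prob_space_factor)
  interpret NP: pair_prob_space ?N ?P ..
  have upd: "(\<lambda>(u, X). fun_upd X i u) \<in> measurable (?N \<Otimes>\<^sub>M ?P) \<mu>"
    unfolding gauss_product_def split_beta by (intro measurable_fun_upd[where J = "- {i}"]) auto
  have G': "G \<in> borel_measurable \<mu>" using G by (simp add: measurable_gauss_product)
  have GU: "(\<lambda>(u, X). G (fun_upd X i u)) \<in> borel_measurable (?N \<Otimes>\<^sub>M ?P)"
    using measurable_compose[OF upd G'] by (simp add: split_beta)
  have Gu: "(\<lambda>X. G (fun_upd X i u)) \<in> borel_measurable ?P" for u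
    using measurable_Pair2[OF GU, of u] by simp
  show meas: "marginal i G \<in> borel_measurable borel"
    using P.borel_measurable_lebesgue_integral[OF GU] unfolding marginal_def[abs_def] by simp
  have B0: "0 \<le> B" using B[of undefined] by linarith
  have int: "integrable ?P (\<lambda>X. G (fun_upd X i u))" for u
    by (rule P.integrable_const_bound[of _ B]) (use B Gu in auto)
  show "\<bar>marginal i G u\<bar> \<le> B"
  proof -
    have "\<bar>marginal i G u\<bar> \<le> (\<integral>X. \<bar>G (fun_upd X i u)\<bar> \<partial>?P)"
      unfolding marginal_def by (rule integral_abs_bound)
    also have "\<dots> \<le> (\<integral>X. B \<partial>?P)"
      by (intro integral_mono integrable_abs int B) simp
    finally show ?thesis by (simp add: P.prob_space)
  qed
  assume h: "integrable ?N h"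
  have h_meas [measurable]: "h \<in> borel_measurable borel"
    using borel_measurable_integrable[OF h] by simp
  have int2: "integrable (?N \<Otimes>\<^sub>M ?P) (\<lambda>(u, X). G (fun_upd X i u) * h u)"
  proof (rule Bochner_Integration.integrable_bound)
    have "integrable (?N \<Otimes>\<^sub>M ?P) (\<lambda>z. h (fst z))"
      by (intro NP.Fubini_integrable) (use h in \<open>auto simp: P.prob_space\<close>)
    then show "integrable (?N \<Otimes>\<^sub>M ?P) (\<lambda>z. B * h (fst z))"
      by (rule Bochner_Integration.integrable_mult_right)
    show "(\<lambda>(u, X). G (fun_upd X i u) * h u) \<in> borel_measurable (?N \<Otimes>\<^sub>M ?P)"
      using GU by (simp add: split_beta)
    show "AE z in ?N \<Otimes>\<^sub>M ?P. norm ((\<lambda>(u, X). G (fun_upd X i u) * h u) z)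
        \<le> norm (B * h (fst z))"
      using B B0 by (intro AE_I2) (auto simp: abs_mult intro!: mult_right_mono)
  qed
  \<comment> \<open>Inserting an independent coordinate \<open>i\<close> into the product over the
    other indices restores \<open>\<mu>\<close>.\<close>
  have "distr (?N \<Otimes>\<^sub>M ?P) \<mu> (\<lambda>(u, X). fun_upd X i u) = \<mu>"
    using distr_pair_PiM_eq_PiM[of "- {i}" "\<lambda>j. gauss_real (a j)" i] prob_space_factor
    by (simp add: gauss_product_def insert_UNIV Compl_insert insert_absorb)
  then have "(\<integral>\<omega>. G \<omega> * h (\<omega> i) \<partial>\<mu>) =
      (\<integral>\<omega>. G \<omega> * h (\<omega> i) \<partial>distr (?N \<Otimes>\<^sub>M ?P) \<mu> (\<lambda>(u, X). fun_upd X i u))"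
    by simp
  also have "\<dots> = (\<integral>z. (case z of (u, X) \<Rightarrow> G (fun_upd X i u) * h u) \<partial>(?N \<Otimes>\<^sub>M ?P))"
    using G' by (subst integral_distr[OF upd]) (auto simp: case_prod_unfold)
  also have "\<dots> = (\<integral>u. (\<integral>X. G (fun_upd X i u) * h u \<partial>?P) \<partial>?N)"
    using NP.integral_fst'[OF int2] by simp
  also have "\<dots> = (\<integral>u. marginal i G u * h u \<partial>?N)"
    by (simp add: marginal_def)
  finally show "(\<integral>\<omega>. G \<omega> * h (\<omega> i) \<partial>\<mu>) = (\<integral>u. marginal i G u * h u \<partial>?N)" .
qed

lemma integrable_gauss_real_id: "integrable (gauss_real (a i)) (\<lambda>u. u)"
  using integrable_normal_moment_nz_1[OF a_pos[of i], of 0]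
  by (subst integrable_real_density) auto

lemma integrable_coordinate: "integrable \<mu> (\<lambda>\<omega>. \<omega> i)"
  using integrable_gauss_real_id[of i] unfolding distr_coordinate[symmetric]
  by (subst (asm) integrable_distr_eq) auto

text \<open>Shifting coordinate \<open>i\<close> of the argument of \<open>G\<close> shifts its
  marginal, which is again bounded and measurable; the one-dimensional derivative formula applies to
  that marginal.\<close>

lemma has_derivative_integral_shift:
  fixes G :: "(nat \<Rightarrow> real) \<Rightarrow> real"
  assumes G [measurable]: "G \<in> borel_measurable borel" and B: "\<And>\<omega>. \<bar>G \<omega>\<bar> \<le> B"
  shows "((\<lambda>t. \<integral>\<omega>. G (fun_upd \<omega> i (\<omega> i + t)) \<partial>\<mu>) has_real_derivative
    (\<integral>\<omega>. G \<omega> * \<omega> i \<partial>\<mu>) / (a i)\<^sup>2) (at 0)"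
proof -
  interpret N: prob_space "gauss_real (a i)" by (rule prob_space_factor)
  have "(\<integral>\<omega>. G (fun_upd \<omega> i (\<omega> i + t)) \<partial>\<mu>) = (\<integral>u. marginal i G (u + t) \<partial>gauss_real (a i))" for t
  proof -
    let ?G = "\<lambda>\<omega>. G (fun_upd \<omega> i (\<omega> i + t))"
    have "(\<lambda>\<omega>. fun_upd \<omega> i (\<omega> i + t)) \<in> borel_measurable (borel :: (nat \<Rightarrow> real) measure)"
    proof (intro borel_measurable_continuous_onI continuous_on_coordinatewise_then_product)
      fix j
      show "continuous_on UNIV (\<lambda>\<omega>. fun_upd \<omega> i (\<omega> i + t) j)"
        by (cases "j = i")
          (auto intro!: continuous_on_add continuous_on_const continuous_on_product_coordinates)
    qed
    then have "?G \<in> borel_measurable borel" using G by (rule measurable_compose)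
    \<comment> \<open>With the constant weight 1 this is plain Fubini; \<open>fun_upd\<close>
      overwrites coordinate \<open>i\<close>, so the marginal of \<open>?G\<close> at
      \<open>u\<close> is that of \<open>G\<close> at \<open>u + t\<close>.\<close>
    from integral_marginal[OF this, of B i "\<lambda>_. 1"] B
    show ?thesis by (simp add: marginal_def)
  qed
  moreover have "(\<integral>\<omega>. G \<omega> * \<omega> i \<partial>\<mu>) = (\<integral>u. marginal i G u * u \<partial>gauss_real (a i))"
    by (intro integral_marginal[OF G B] integrable_gauss_real_id)
  ultimately show ?thesis
    using has_derivative_gauss_real_shift[OF measurable_marginal[OF G B] abs_marginal_le[OF G B] a_pos]
    by simp
qed

text \<open>\<open>G\<close> is tested against its own projection \<open>T\<close> onto the span of
  the normalised coordinates: both the inner product of \<open>G\<close> with \<open>T\<close> and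
  the second moment of \<open>T\<close> equal \<open>D\<close>.\<close>

lemma bessel_inequality:
  fixes G :: "(nat \<Rightarrow> real) \<Rightarrow> real"
  assumes G: "G \<in> borel_measurable borel" and B: "\<And>\<omega>. \<bar>G \<omega>\<bar> \<le> B"
  shows "(\<Sum>i<n. ((\<integral>\<omega>. G \<omega> * \<omega> i \<partial>\<mu>) / a i)\<^sup>2) \<le> B\<^sup>2"
proof -
  define d where "d i = (\<integral>\<omega>. G \<omega> * \<omega> i \<partial>\<mu>) / a i" for i
  \<comment> \<open>Vanishing coefficients are dropped because
    \<open>distributed_linear_combination\<close> asks for nonzero ones.\<close>
  define I where "I = {i. i < n \<and> d i \<noteq> 0}"
  define D where "D = (\<Sum>i\<in>I. (d i)\<^sup>2)"
  define T where "T \<omega> = (\<Sum>i\<in>I. d i / a i * \<omega> i)" for \<omega> :: "nat \<Rightarrow> real"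
  have [measurable]: "G \<in> borel_measurable \<mu>" using G by (simp add: measurable_gauss_product)
  have I: "finite I" "\<And>i. i \<in> I \<Longrightarrow> d i \<noteq> 0" by (auto simp: I_def)
  have a0: "a i \<noteq> 0" for i using a_pos[of i] by simp
  have "(\<Sum>i<n. (d i)\<^sup>2) = D"
    unfolding D_def by (rule sum.mono_neutral_right) (auto simp: I_def)
  moreover have "D \<le> B\<^sup>2"
  proof (cases "I = {}")
    case False
    have Dpos: "0 < D"
      unfolding D_def using I False by (intro sum_pos) auto
    have "distributed \<mu> lborel T (\<lambda>t. ennreal (normal_density 0 (sqrt D) t))"
      using distributed_linear_combination[of I "\<lambda>i. d i / a i"] I False a0
      by (simp add: T_def[abs_def] D_def)
    note T2 = centered_normal_second_moment[OF _ this]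
    have intG: "integrable \<mu> (\<lambda>\<omega>. G \<omega> * \<omega> i)" for i
    proof (rule Bochner_Integration.integrable_bound)
      show "integrable \<mu> (\<lambda>\<omega>. B * \<omega> i)"
        by (intro Bochner_Integration.integrable_mult_right integrable_coordinate)
      have "0 \<le> B" using B[of undefined] by linarith
      then show "AE \<omega> in \<mu>. norm (G \<omega> * \<omega> i) \<le> norm (B * \<omega> i)"
        using B by (intro AE_I2) (auto simp: abs_mult intro: mult_right_mono)
    qed auto
    have GT: "G \<omega> * T \<omega> = (\<Sum>i\<in>I. d i / a i * (G \<omega> * \<omega> i))" for \<omega>
      by (simp add: T_def sum_distrib_left mult_ac)
    have "D = (\<Sum>i\<in>I. d i / a i * (\<integral>\<omega>. G \<omega> * \<omega> i \<partial>\<mu>))"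
      by (simp add: D_def d_def power2_eq_square)
    also have "\<dots> = (\<integral>\<omega>. G \<omega> * T \<omega> \<partial>\<mu>)"
      unfolding GT by (subst Bochner_Integration.integral_sum) (use intG in auto)
    \<comment> \<open>From \<open>2 * G * T \<le> G\<^sup>2 + T\<^sup>2\<close> one gets
      \<open>D \<le> (B\<^sup>2 + D) / 2\<close>, hence \<open>D \<le> B\<^sup>2\<close>.\<close>
    also have "\<dots> \<le> (\<integral>\<omega>. (B\<^sup>2 + (T \<omega>)\<^sup>2) / 2 \<partial>\<mu>)"
    proof (rule integral_mono)
      show "integrable \<mu> (\<lambda>\<omega>. G \<omega> * T \<omega>)" unfolding GT using intG by auto
      show "integrable \<mu> (\<lambda>\<omega>. (B\<^sup>2 + (T \<omega>)\<^sup>2) / 2)" using T2(1) Dpos by simp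
      fix \<omega>
      have "(G \<omega>)\<^sup>2 \<le> B\<^sup>2" using B[of \<omega>] by (metis abs_ge_zero power_mono power2_abs)
      then show "G \<omega> * T \<omega> \<le> (B\<^sup>2 + (T \<omega>)\<^sup>2) / 2"
        using sum_squares_bound[of "G \<omega>" "T \<omega>"] by simp
    qed
    also have "\<dots> = (B\<^sup>2 + D) / 2" using T2 Dpos by (simp add: prob_space)
    finally show ?thesis by simp
  qed (simp add: D_def)
  ultimately show ?thesis by (simp add: d_def)
qed

section \<open>Partial derivatives of the convolution and the upper bound for exponents at least
  2\<close>

lemma partial_deriv_gauss_conv:
  fixes f :: "ell2 \<Rightarrow> real"
  assumes f: "f \<in> borel_measurable borel" and B: "\<And>y. \<bar>f y\<bar> \<le> B"
  shows "partial_deriv i (gauss_conv a f) x = (\<integral>\<omega>. translate f x \<omega> * \<omega> i \<partial>\<mu>) / (a i)\<^sup>2"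
proof -
  from has_derivative_integral_shift[OF measurable_translate[OF f] abs_translate_le[OF B]]
  show ?thesis
    unfolding partial_deriv_def gauss_conv_eq_integral[OF f] translate_unit_ell2
    by (rule DERIV_imp_deriv)
qed

text \<open>The weight \<open>a i\<close> turns each derivative into a Bessel coefficient
  \<open>d i\<close>. Since \<open>p - 2\<close> is nonnegative and
  \<open>\<bar>d i\<bar> \<le> B\<close>, the factor \<open>\<bar>d i\<bar> powr (p - 2)\<close> is
  bounded and a square remains to be summed.\<close>

lemma suminf_partial_deriv_le:
  fixes f :: "ell2 \<Rightarrow> real"
  assumes f: "f \<in> borel_measurable borel" and B: "\<And>y. \<bar>f y\<bar> \<le> B" and p: "2 \<le> p"
  shows "(\<Sum>i. ennreal (a i powr p * \<bar>partial_deriv i (gauss_conv a f) x\<bar> powr p)) \<le> ennreal (B powr p)"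
proof -
  define d where "d i = (\<integral>\<omega>. translate f x \<omega> * \<omega> i \<partial>\<mu>) / a i" for i
  have B0: "0 \<le> B" using B[of 0] by linarith
  have bes: "(\<Sum>i<n. (d i)\<^sup>2) \<le> B\<^sup>2" for n
    unfolding d_def by (intro bessel_inequality measurable_translate abs_translate_le f B)
  have dB: "\<bar>d i\<bar> \<le> B" for i
  proof -
    have "(d i)\<^sup>2 \<le> (\<Sum>i<Suc i. (d i)\<^sup>2)" by (rule member_le_sum) auto
    then show ?thesis using bes[of "Suc i"] B0 by (metis abs_le_square_iff abs_of_nonneg order_trans)
  qed
  have eq: "a i powr p * \<bar>partial_deriv i (gauss_conv a f) x\<bar> powr p = \<bar>d i\<bar> powr p" for i
  proof -
    have "a i powr p * \<bar>partial_deriv i (gauss_conv a f) x\<bar> powr p =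
        (a i * \<bar>partial_deriv i (gauss_conv a f) x\<bar>) powr p"
      using a_pos[of i] by (simp add: powr_mult)
    also have "a i * \<bar>partial_deriv i (gauss_conv a f) x\<bar> = \<bar>d i\<bar>"
      using a_pos[of i]
      by (simp add: partial_deriv_gauss_conv[OF f B] d_def abs_mult power2_eq_square)
    finally show ?thesis .
  qed
  have le: "\<bar>d i\<bar> powr p \<le> B powr (p - 2) * (d i)\<^sup>2" for i
  proof (cases "d i = 0")
    case False
    have "\<bar>d i\<bar> powr p = \<bar>d i\<bar> powr (p - 2) * \<bar>d i\<bar> powr 2"
      by (subst powr_add[symmetric]) simp
    also have "\<dots> \<le> B powr (p - 2) * \<bar>d i\<bar> powr 2"
      using p dB by (intro mult_right_mono powr_mono2) auto
    finally show ?thesis using False by simp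
  qed simp
  have "(\<Sum>i<n. ennreal (\<bar>d i\<bar> powr p)) \<le> ennreal (B powr p)" for n
  proof -
    have "(\<Sum>i<n. \<bar>d i\<bar> powr p) \<le> (\<Sum>i<n. B powr (p - 2) * (d i)\<^sup>2)"
      by (intro sum_mono le)
    also have "\<dots> \<le> B powr (p - 2) * B\<^sup>2"
      using bes[of n] by (simp add: mult_left_mono flip: sum_distrib_left)
    \<comment> \<open>For \<open>B = 0\<close> both sides are 0, as \<open>0 powr z = 0\<close> for
      every \<open>z\<close>; otherwise the exponents add.\<close>
    also have "\<dots> \<le> B powr p"
      using B0 by (cases "B = 0") (simp_all flip: powr_numeral powr_add)
    finally show ?thesis by (subst sum_ennreal) (auto simp: ennreal_leI)
  qed
  then show ?thesis
    unfolding eq by (intro suminf_le_const) auto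
qed

section \<open>Sine waves and the lower bound that excludes exponents below 2\<close>

definition sine_wave :: "nat \<Rightarrow> ell2 \<Rightarrow> real" where
  "sine_wave n x = sin (\<Sum>i<n. coord x i / (a i * sqrt n))"

lemma continuous_on_coord: "continuous_on A (\<lambda>x. coord x i)"
proof -
  have "dist (coord x i) (coord y i) \<le> 1 * dist x y" for x y
    using abs_coord_le_norm[of "x - y" i] by (simp add: dist_norm)
  then have "1-lipschitz_on A (\<lambda>x. coord x i)" by (intro lipschitz_onI) auto
  then show ?thesis by (rule lipschitz_on_continuous_on)
qed

lemma measurable_sine_wave: "sine_wave n \<in> borel_measurable borel"
  unfolding sine_wave_def[abs_def]
  by (intro borel_measurable_continuous_onI continuous_intros continuous_on_coord)
    (use a_pos in \<open>auto simp: less_le\<close>)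

lemma abs_sine_wave_le: "\<bar>sine_wave n x\<bar> \<le> 1"
  by (simp add: sine_wave_def)

text \<open>The constant sees \<open>f\<close> only through its supremum, so this must be exactly
  the same number for all \<open>n\<close>; an upper bound would not suffice.\<close>

lemma Sup_abs_sine_wave:
  assumes n: "0 < n"
  shows "(SUP x. \<bar>sine_wave n x\<bar>) = 1"
proof (rule cSup_eq_maximum)
  \<comment> \<open>A point on the axis of coordinate 0, which occurs in the sum as \<open>n\<close>
    is positive, scaled to give the phase \<open>pi / 2\<close>.\<close>
  let ?x = "(pi / 2 * (a 0 * sqrt n)) *\<^sub>R unit_ell2 0"
  have "coord ?x i / (a i * sqrt n) = (if i = 0 then pi / 2 else 0)" for i
    using n a_pos[of 0] by (simp add: unit_ell2.rep_eq)
  then have "sine_wave n ?x = 1"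
    using n by (simp add: sine_wave_def sum.delta del: coord_simps)
  then show "1 \<in> range (\<lambda>x. \<bar>sine_wave n x\<bar>)"
    by (metis abs_one rangeI)
qed (auto simp: abs_sine_wave_le)

text \<open>A step \<open>t\<close> along direction \<open>i\<close> adds
  \<open>t / (a i * sqrt n)\<close> to the phase, whose random part \<open>Y\<close> is standard
  normal. The convolution along this line is therefore an explicit sine.\<close>

lemma partial_deriv_sine_wave:
  assumes a: "summable a" and i: "i < n"
  shows "partial_deriv i (gauss_conv a (sine_wave n)) 0 = exp (- 1 / 2) / (a i * sqrt n)"
proof -
  define Y where "Y \<omega> = (\<Sum>j<n. 1 / (a j * sqrt n) * \<omega> j)" for \<omega> :: "nat \<Rightarrow> real"
  have a0: "a j \<noteq> 0" for j using a_pos[of j] by simp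
  \<comment> \<open>Each of the \<open>n\<close> independent summands has variance
    \<open>1 / n\<close>, so the total variance is 1.\<close>
  have "distributed \<mu> lborel Y (\<lambda>t. ennreal (std_normal_density t))"
    using distributed_linear_combination[of "{..<n}" "\<lambda>j. 1 / (a j * sqrt n)"] i a0
    by (simp add: Y_def[abs_def] power_divide real_sqrt_pow2 lessThan_empty_iff)
  note Y = distributed_integral[OF this]
  have Y_meas [measurable]: "Y \<in> borel_measurable borel"
    unfolding Y_def[abs_def] by measurable
  have conv: "gauss_conv a (sine_wave n) (0 + t *\<^sub>R unit_ell2 i) =
      exp (- 1 / 2) * sin (t / (a i * sqrt n))" for t
  proof -
    have "sine_wave n (t *\<^sub>R unit_ell2 i + Abs_ell2 \<omega>) = sin (Y \<omega> + t / (a i * sqrt n))"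
      if "\<omega> \<in> sq_summable" for \<omega>
    proof -
      have "(\<Sum>j<n. coord (t *\<^sub>R unit_ell2 i + Abs_ell2 \<omega>) j / (a j * sqrt n)) =
          (\<Sum>j<n. (if j = i then t / (a i * sqrt n) else 0) + 1 / (a j * sqrt n) * \<omega> j)"
        using that by (intro sum.cong) (auto simp: coord_Abs_ell2 unit_ell2.rep_eq add_divide_distrib)
      also have "\<dots> = Y \<omega> + t / (a i * sqrt n)"
        using i by (simp add: sum.distrib Y_def)
      finally show ?thesis by (simp add: sine_wave_def)
    qed
    \<comment> \<open>Off \<open>sq_summable\<close> the left side is 0, so the identity holds only
      almost everywhere; summability of \<open>a\<close> makes the exceptional set null.\<close>
    then have eq: "AE \<omega> in \<mu>. translate (sine_wave n) (0 + t *\<^sub>R unit_ell2 i) \<omega> =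
        sin (Y \<omega> + t / (a i * sqrt n))"
      using AE_sq_summable[OF a] by (auto simp: translate_def elim!: eventually_mono)
    have "gauss_conv a (sine_wave n) (0 + t *\<^sub>R unit_ell2 i) =
        (\<integral>\<omega>. sin (Y \<omega> + t / (a i * sqrt n)) \<partial>\<mu>)"
      unfolding gauss_conv_eq_integral[OF measurable_sine_wave]
      by (rule integral_cong_AE)
        (use eq measurable_translate[OF measurable_sine_wave] in
          \<open>auto simp: measurable_gauss_product\<close>)
    also have "\<dots> = (\<integral>u. std_normal_density u * sin (u + t / (a i * sqrt n)) \<partial>lborel)"
      by (rule Y[symmetric]) auto
    finally show ?thesis by (simp add: integral_std_normal_sin_shift)
  qed
  show ?thesis
    unfolding partial_deriv_def conv
    by (rule DERIV_imp_deriv) (use a0 i in \<open>auto intro!: derivative_eq_intros\<close>)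
qed

text \<open>The first \<open>n\<close> terms all equal
  \<open>(exp (- 1 / 2) / sqrt n) powr p\<close>; adding them raises the exponent of
  \<open>n\<close> by 1, and the other terms are nonnegative.\<close>

lemma le_suminf_partial_deriv_sine_wave:
  assumes a: "summable a" and p: "0 < p" and n: "0 < n"
  shows "ennreal (exp (- p / 2) * real n powr (1 - p / 2)) \<le>
    (\<Sum>i. ennreal (a i powr p * \<bar>partial_deriv i (gauss_conv a (sine_wave n)) 0\<bar> powr p))"
proof -
  let ?s = "\<lambda>i. a i powr p * \<bar>partial_deriv i (gauss_conv a (sine_wave n)) 0\<bar> powr p"
  have "?s i = exp (- p / 2) * real n powr (- p / 2)" if "i < n" for i
  proof -
    have "?s i = (a i * \<bar>partial_deriv i (gauss_conv a (sine_wave n)) 0\<bar>) powr p"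
      using a_pos[of i] by (simp add: powr_mult)
    also have "a i * \<bar>partial_deriv i (gauss_conv a (sine_wave n)) 0\<bar> =
        exp (- 1 / 2) * real n powr (- 1 / 2)"
      using a_pos[of i] n
      by (simp add: partial_deriv_sine_wave[OF a that] abs_mult powr_minus_divide powr_half_sqrt)
    also have "\<dots> powr p = exp (- p / 2) * real n powr (- p / 2)"
      by (simp add: powr_mult powr_powr exp_powr_real)
    finally show ?thesis .
  qed
  then have "(\<Sum>i<n. ?s i) = exp (- p / 2) * (real n powr 1 * real n powr (- p / 2))"
    using n by simp
  also have "\<dots> = exp (- p / 2) * real n powr (1 - p / 2)"
    by (subst powr_add[symmetric]) simp
  finally have "ennreal (exp (- p / 2) * real n powr (1 - p / 2)) = (\<Sum>i<n. ennreal (?s i))"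
    by (subst sum_ennreal) auto
  also have "\<dots> \<le> (\<Sum>i. ennreal (?s i))"
    by (rule sum_le_suminf) auto
  finally show ?thesis .
qed

end

theorem theorem2p10:
  fixes a :: "nat \<Rightarrow> real" and p :: real
  assumes "\<And>i. 0 < a i" and "summable a" and "0 < p"
  shows "(\<exists>C :: real \<Rightarrow> real \<Rightarrow> real. \<forall>f :: ell2 \<Rightarrow> real.
            f \<in> borel_measurable borel \<longrightarrow> bounded (range f) \<longrightarrow>
              0 < C p (SUP x. \<bar>f x\<bar>) \<and>
              (\<forall>x. (\<Sum>i. ennreal (a i powr p * \<bar>partial_deriv i (gauss_conv a f) x\<bar> powr p))
                     \<le> ennreal (C p (SUP x. \<bar>f x\<bar>))))
         \<longleftrightarrow> 2 \<le> p"
    (is "(\<exists>C. ?P C) \<longleftrightarrow> _")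
proof
  interpret gauss_seq a using assms(1) by unfold_locales
  assume "\<exists>C. ?P C"
  then obtain C where C: "?P C" ..
  show "2 \<le> p"
  proof (rule ccontr)
    assume "\<not> 2 \<le> p"
    then have p: "0 < 1 - p / 2" by simp
    \<comment> \<open>All sine waves have supremum 1, so the single number \<open>C p 1\<close> has
      to serve every \<open>n\<close>.\<close>
    have bound: "exp (- p / 2) * real n powr (1 - p / 2) \<le> C p 1" if n: "0 < n" for n
    proof -
      have "bounded (range (sine_wave n))"
        by (rule boundedI[of _ 1]) (auto simp: abs_sine_wave_le)
      note Cn = C[THEN spec, THEN mp, THEN mp, OF measurable_sine_wave this,
          unfolded Sup_abs_sine_wave[OF n]]
      have "ennreal (exp (- p / 2) * real n powr (1 - p / 2)) \<le> ennreal (C p 1)"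
        using le_suminf_partial_deriv_sine_wave[OF assms(2,3) n] Cn[THEN conjunct2, THEN spec]
        by (rule order_trans)
      \<comment> \<open>Positivity of \<open>C p 1\<close> matters here: \<open>ennreal\<close>
        sends negative reals to 0, so the order can be pulled back only for a nonnegative right
        side.\<close>
      then show ?thesis using Cn[THEN conjunct1] by (simp only: ennreal_le_iff less_imp_le)
    qed
    have "filterlim (\<lambda>n. real n powr (1 - p / 2)) at_top sequentially"
      by (rule filterlim_compose[OF real_powr_at_top[OF p] filterlim_real_sequentially])
    then have "eventually (\<lambda>n. C p 1 / exp (- p / 2) < real n powr (1 - p / 2)) sequentially"
      by (simp add: filterlim_at_top_dense)
    then have "eventually (\<lambda>n. C p 1 / exp (- p / 2) < real n powr (1 - p / 2) \<and> 0 < n) sequentially"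
      using eventually_gt_at_top[of 0] by eventually_elim simp
    then obtain n where "C p 1 / exp (- p / 2) < real n powr (1 - p / 2)" "0 < n"
      using eventually_happens'[OF sequentially_bot] by blast
    with bound[of n] show False by (simp add: divide_less_eq mult.commute)
  qed
next
  interpret gauss_seq a using assms(1) by unfold_locales
  assume p: "2 \<le> p"
  show "\<exists>C. ?P C"
  \<comment> \<open>The added 1 keeps the constant positive when \<open>f\<close> vanishes
    identically.\<close>
  proof (rule exI[of _ "\<lambda>p M. M powr p + 1"], intro allI impI conjI)
    fix f :: "ell2 \<Rightarrow> real" and x
    assume f: "f \<in> borel_measurable borel" and bdd: "bounded (range f)"
    let ?M = "SUP x. \<bar>f x\<bar>"
    show "0 < ?M powr p + 1" by (simp add: add_nonneg_pos)
    obtain K where "\<And>y. \<bar>f y\<bar> \<le> K" using bdd by (auto simp: bounded_iff)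
    then have "\<bar>f y\<bar> \<le> ?M" for y by (intro cSUP_upper bdd_aboveI2) auto
    from suminf_partial_deriv_le[OF f this p]
    have "(\<Sum>i. ennreal (a i powr p * \<bar>partial_deriv i (gauss_conv a f) x\<bar> powr p)) \<le> ennreal (?M powr p)" .
    also have "\<dots> \<le> ennreal (?M powr p + 1)" by (intro ennreal_leI) simp
    finally show "(\<Sum>i. ennreal (a i powr p * \<bar>partial_deriv i (gauss_conv a f) x\<bar> powr p))
        \<le> ennreal (?M powr p + 1)" .
  qed
qed

end
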